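(* Let $T$ be a tree of diameter $d$ and metric dimension $k$, where $k\geq 2$. Then \[ |V(T)| \leq \begin{cases} \frac{1}{8}(kd+4)(d+2) & \text{if } d \text{ is even},\\ \frac{1}{8}(kd-k+8)(d+1) & \text{if } d \text{ is odd}.\end{cases}\] Equality holds for even $d$ if and only if $T=HS_{d,k}$, and for odd $d$ if and only if $T=HS_{d,k,a}$ for some integer $a$ with $0<a<k$.
   Context: A set $R$ of vertices of a graph $G$ is a resolving set if for each pair $u,v$ of distinct vertices there is $x\in R$ with $d(x,u)\neq d(x,v)$; the metric dimension of $G$ is the smallest size of a resolving set. For $r\in\mathbb{N}$, let $L_r$ be the rooted tree obtained from a path $v_0,v_1,\ldots,v_r$ rooted at $v_0$ by attaching (at one of its end vertices) a path of length $r-i$ to vertex $v_i$ for $i=1,2,\ldots,r-1$. Let $P_r^*$ denote a path of length $r$ rooted at one of its end vertices. Let $k\geq 2$. For even $d$, the hairy spider $HS_{d,k}$ is the tree obtained from $k$ disjoint copies of $L_{d/2}$ and one path $P^*_{d/2}$ by identifying all their roots into a single vertex $v$. For odd $d\geq 3$ and an integer $a$ with $0\leq a\leq k$, $HS_{d,k,a}$ is the tree obtained from $k$ disjoint copies of $L_{(d-1)/2}$, two copies of $P^*_{(d-1)/2}$, and a path on two vertices $u,w$, by identifying the roots of $a$ copies of $L_{(d-1)/2}$ and of one copy of $P^*_{(d-1)/2}$ with $u$, and the roots of the remaining $k-a$ copies of $L_{(d-1)/2}$ and of the other copy of $P^*_{(d-1)/2}$ with $w$. *)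

theory Defs
  imports Complex_Main
begin

definition simple_graph :: "'a set \<Rightarrow> ('a \<Rightarrow> 'a \<Rightarrow> bool) \<Rightarrow> bool" where
  "simple_graph V E \<longleftrightarrow> finite V \<and> (\<forall>x y. E x y \<longrightarrow> x \<in> V \<and> y \<in> V)
     \<and> (\<forall>x y. E x y \<longrightarrow> E y x) \<and> (\<forall>x. \<not> E x x)"

definition is_walk :: "('a \<Rightarrow> 'a \<Rightarrow> bool) \<Rightarrow> 'a list \<Rightarrow> bool" where
  "is_walk E xs \<longleftrightarrow> xs \<noteq> [] \<and> (\<forall>i. Suc i < length xs \<longrightarrow> E (xs ! i) (xs ! Suc i))"

definition connected_graph :: "'a set \<Rightarrow> ('a \<Rightarrow> 'a \<Rightarrow> bool) \<Rightarrow> bool" where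
  "connected_graph V E \<longleftrightarrow>
     (\<forall>u\<in>V. \<forall>v\<in>V. \<exists>xs. is_walk E xs \<and> hd xs = u \<and> last xs = v)"

definition has_cycle :: "'a set \<Rightarrow> ('a \<Rightarrow> 'a \<Rightarrow> bool) \<Rightarrow> bool" where
  "has_cycle V E \<longleftrightarrow> (\<exists>xs. 3 \<le> length xs \<and> distinct xs \<and> set xs \<subseteq> V
      \<and> is_walk E xs \<and> E (last xs) (hd xs))"

definition is_tree :: "'a set \<Rightarrow> ('a \<Rightarrow> 'a \<Rightarrow> bool) \<Rightarrow> bool" where
  "is_tree V E \<longleftrightarrow> simple_graph V E \<and> V \<noteq> {} \<and> connected_graph V E \<and> \<not> has_cycle V E"

definition gdist :: "('a \<Rightarrow> 'a \<Rightarrow> bool) \<Rightarrow> 'a \<Rightarrow> 'a \<Rightarrow> nat" where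
  "gdist E u v = (LEAST n. \<exists>xs. is_walk E xs \<and> hd xs = u \<and> last xs = v \<and> length xs = Suc n)"

definition diameter :: "'a set \<Rightarrow> ('a \<Rightarrow> 'a \<Rightarrow> bool) \<Rightarrow> nat" where
  "diameter V E = Max {gdist E u v | u v. u \<in> V \<and> v \<in> V}"

definition resolving_set :: "'a set \<Rightarrow> ('a \<Rightarrow> 'a \<Rightarrow> bool) \<Rightarrow> 'a set \<Rightarrow> bool" where
  "resolving_set V E R \<longleftrightarrow> R \<subseteq> V \<and>
     (\<forall>u\<in>V. \<forall>v\<in>V. u \<noteq> v \<longrightarrow> (\<exists>x\<in>R. gdist E x u \<noteq> gdist E x v))"

definition metric_dim :: "'a set \<Rightarrow> ('a \<Rightarrow> 'a \<Rightarrow> bool) \<Rightarrow> nat" where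
  "metric_dim V E = (LEAST n. \<exists>R. resolving_set V E R \<and> card R = n)"

definition graph_iso :: "'a set \<Rightarrow> ('a \<Rightarrow> 'a \<Rightarrow> bool) \<Rightarrow> 'b set \<Rightarrow> ('b \<Rightarrow> 'b \<Rightarrow> bool) \<Rightarrow> bool" where
  "graph_iso V E V' E' \<longleftrightarrow> (\<exists>f. bij_betw f V V' \<and> (\<forall>x\<in>V. \<forall>y\<in>V. E x y \<longleftrightarrow> E' (f x) (f y)))"

text \<open>L_r: spine vertices (i,0), i=0..r, root (0,0); at (i,0), 1<=i<=r-1, a pendant path
  (i,0),(i,1),...,(i,r-i).\<close>
definition L_verts :: "nat \<Rightarrow> (nat \<times> nat) set" where
  "L_verts r = {(i, j). i \<le> r \<and> j \<le> (if i = 0 then 0 else r - i)}"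

definition L_edge :: "nat \<Rightarrow> nat \<times> nat \<Rightarrow> nat \<times> nat \<Rightarrow> bool" where
  "L_edge r p q \<longleftrightarrow> (case (p, q) of ((i, j), (i', j')) \<Rightarrow>
      (j = 0 \<and> j' = 0 \<and> i' = Suc i \<and> i' \<le> r) \<or>
      (i = i' \<and> 1 \<le> i \<and> j' = Suc j \<and> j' \<le> r - i))"

definition P_verts :: "nat \<Rightarrow> (nat \<times> nat) set" where
  "P_verts r = {(i, j). i \<le> r \<and> j = 0}"

definition P_edge :: "nat \<Rightarrow> nat \<times> nat \<Rightarrow> nat \<times> nat \<Rightarrow> bool" where
  "P_edge r p q \<longleftrightarrow> (case (p, q) of ((i, j), (i', j')) \<Rightarrow>
      j = 0 \<and> j' = 0 \<and> i' = Suc i \<and> i' \<le> r)"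

text \<open>Raw vertex (c,i,j): copy c<k is a copy of L_{d/2}, copy c=k is P*_{d/2}.
  All roots (i = 0) are identified into the single vertex (0,0,0).\<close>
definition HSe_raw_V :: "nat \<Rightarrow> nat \<Rightarrow> (nat \<times> nat \<times> nat) set" where
  "HSe_raw_V d k = {(c, i, j). (c < k \<and> (i, j) \<in> L_verts (d div 2)) \<or>
                               (c = k \<and> (i, j) \<in> P_verts (d div 2))}"

definition HSe_raw_E :: "nat \<Rightarrow> nat \<Rightarrow> nat \<times> nat \<times> nat \<Rightarrow> nat \<times> nat \<times> nat \<Rightarrow> bool" where
  "HSe_raw_E d k p q \<longleftrightarrow> (case (p, q) of ((c, i, j), (c', i', j')) \<Rightarrow>
      c = c' \<and> ((c < k \<and> L_edge (d div 2) (i, j) (i', j')) \<or>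
                 (c = k \<and> P_edge (d div 2) (i, j) (i', j'))))"

definition HSe_norm :: "nat \<times> nat \<times> nat \<Rightarrow> nat \<times> nat \<times> nat" where
  "HSe_norm p = (case p of (c, i, j) \<Rightarrow> if i = 0 then (0, 0, 0) else (c, i, j))"

definition HS_even_V :: "nat \<Rightarrow> nat \<Rightarrow> (nat \<times> nat \<times> nat) set" where
  "HS_even_V d k = HSe_norm ` HSe_raw_V d k"

definition HS_even_E :: "nat \<Rightarrow> nat \<Rightarrow> nat \<times> nat \<times> nat \<Rightarrow> nat \<times> nat \<times> nat \<Rightarrow> bool" where
  "HS_even_E d k x y \<longleftrightarrow> (\<exists>p q. p \<in> HSe_raw_V d k \<and> q \<in> HSe_raw_V d k \<and> HSe_raw_E d k p q \<and>
      ((x = HSe_norm p \<and> y = HSe_norm q) \<or> (x = HSe_norm q \<and> y = HSe_norm p)))"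

text \<open>Copies c<k are copies of L_{(d-1)/2}; c=k and c=k+1 are copies of P*_{(d-1)/2}.
  Roots of copies c<a and of copy k are identified with u=(0,0,0);
  roots of copies a<=c<k and of copy k+1 with w=(0,0,1); u and w are adjacent.\<close>
definition HSo_raw_V :: "nat \<Rightarrow> nat \<Rightarrow> (nat \<times> nat \<times> nat) set" where
  "HSo_raw_V d k = {(c, i, j). (c < k \<and> (i, j) \<in> L_verts ((d - 1) div 2)) \<or>
                               ((c = k \<or> c = Suc k) \<and> (i, j) \<in> P_verts ((d - 1) div 2))}"

definition HSo_raw_E :: "nat \<Rightarrow> nat \<Rightarrow> nat \<times> nat \<times> nat \<Rightarrow> nat \<times> nat \<times> nat \<Rightarrow> bool" where
  "HSo_raw_E d k p q \<longleftrightarrow> (case (p, q) of ((c, i, j), (c', i', j')) \<Rightarrow>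
      c = c' \<and> ((c < k \<and> L_edge ((d - 1) div 2) (i, j) (i', j')) \<or>
                 ((c = k \<or> c = Suc k) \<and> P_edge ((d - 1) div 2) (i, j) (i', j'))))"

definition HSo_norm :: "nat \<Rightarrow> nat \<Rightarrow> nat \<times> nat \<times> nat \<Rightarrow> nat \<times> nat \<times> nat" where
  "HSo_norm k a p = (case p of (c, i, j) \<Rightarrow>
      if i = 0 then (if c < a \<or> c = k then (0, 0, 0) else (0, 0, 1)) else (c, i, j))"

definition HS_odd_V :: "nat \<Rightarrow> nat \<Rightarrow> nat \<Rightarrow> (nat \<times> nat \<times> nat) set" where
  "HS_odd_V d k a = HSo_norm k a ` HSo_raw_V d k"

definition HS_odd_E :: "nat \<Rightarrow> nat \<Rightarrow> nat \<Rightarrow> nat \<times> nat \<times> nat \<Rightarrow> nat \<times> nat \<times> nat \<Rightarrow> bool" where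
  "HS_odd_E d k a x y \<longleftrightarrow>
     ((x = (0, 0, 0) \<and> y = (0, 0, 1)) \<or> (x = (0, 0, 1) \<and> y = (0, 0, 0))) \<or>
     (\<exists>p q. p \<in> HSo_raw_V d k \<and> q \<in> HSo_raw_V d k \<and> HSo_raw_E d k p q \<and>
      ((x = HSo_norm k a p \<and> y = HSo_norm k a q) \<or> (x = HSo_norm k a q \<and> y = HSo_norm k a p)))"

end

theory Submission
  imports Defs
begin

text \<open>Root the tree at the middle vertex of a longest path or, for odd \<open>d\<close>, at one end of its
  middle edge, the other end being a second centre; then every vertex is within
  \<open>r = d div 2\<close> of the centre on its side. Let the spine consist of the centres and all
  ancestors of a resolving set \<open>R\<close> of size \<open>k\<close>. Two vertices of equal depth which leave the spine
  at the same vertex have the same distances to \<open>R\<close>, so what hangs off a spine vertex is a path.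
  Choosing for each spine vertex a landmark below it thus maps the tree injectively into the
  vertex set of a hairy spider. If the sizes agree, the map is bijective, every spine vertex
  outside the centres lies above exactly one landmark, and the map commutes with taking parents.
  In the odd case both sides then contain a landmark, as otherwise the spider has two vertices
  at equal distances from all landmarks.\<close>

section \<open>Distances in a graph\<close>

text \<open>Trades vertex lists for powers of the edge relation, where concatenating and reversing
  walks is simple. The exponent counts edges, hence \<open>Suc n\<close> vertices.\<close>

lemma walk_iff_relpowp:
  "(\<exists>xs. is_walk E xs \<and> hd xs = u \<and> last xs = v \<and> length xs = Suc n) \<longleftrightarrow> (E ^^ n) u v"
proof
  assume "\<exists>xs. is_walk E xs \<and> hd xs = u \<and> last xs = v \<and> length xs = Suc n"
  then obtain xs where xs: "is_walk E xs" "hd xs = u" "last xs = v" "length xs = Suc n"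
    by blast
  have "xs \<noteq> []" using xs(4) by auto
  then have "xs ! 0 = u" "xs ! n = v"
    using xs(2-4) by (auto simp: hd_conv_nth last_conv_nth)
  moreover have "\<forall>i<n. E (xs ! i) (xs ! Suc i)"
    using xs(1,4) by (auto simp: is_walk_def)
  ultimately show "(E ^^ n) u v"
    unfolding relpowp_fun_conv by blast
next
  assume "(E ^^ n) u v"
  then obtain f where f: "f 0 = u" "f n = v" "\<And>i. i < n \<Longrightarrow> E (f i) (f (Suc i))"
    unfolding relpowp_fun_conv by blast
  let ?xs = "map f [0..<Suc n]"
  have nth: "?xs ! i = f i" if "i < Suc n" for i
    using that by (simp only: nth_map_upt) simp
  have "is_walk E ?xs"
    unfolding is_walk_def
  proof (intro conjI allI impI)
    fix i assume "Suc i < length ?xs"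
    then have "i < n" by simp
    then show "E (?xs ! i) (?xs ! Suc i)"
      using f(3)[of i] nth[of i] nth[of "Suc i"] by simp
  qed simp
  moreover have "hd ?xs = u"
    using f(1) by (simp add: hd_map del: upt_Suc)
  moreover have "last ?xs = v"
    using f(2) by simp
  moreover have "length ?xs = Suc n" by simp
  ultimately show "\<exists>xs. is_walk E xs \<and> hd xs = u \<and> last xs = v \<and> length xs = Suc n"
    by blast
qed

lemma gdist_eq_Least: "gdist E u v = (LEAST n. (E ^^ n) u v)"
  by (simp add: gdist_def walk_iff_relpowp)

text \<open>Cycles need distinct vertices. When the vertex to be prepended already occurs, the walk
  is cut back to the suffix that starts there.\<close>

lemma rtranclp_imp_distinct_walk:
  assumes "E\<^sup>*\<^sup>* u v"
  shows "\<exists>xs. is_walk E xs \<and> distinct xs \<and> hd xs = u \<and> last xs = v"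
  using assms
proof (induction rule: converse_rtranclp_induct)
  case base
  show ?case by (rule exI[of _ "[v]"]) (simp add: is_walk_def)
next
  case (step y z)
  then obtain xs where xs: "is_walk E xs" "distinct xs" "hd xs = z" "last xs = v" by blast
  show ?case
  proof (cases "y \<in> set xs")
    case True
    then obtain as bs where ab: "xs = as @ y # bs" by (meson split_list)
    have "is_walk E (y # bs)"
      unfolding is_walk_def
    proof (intro conjI allI impI)
      fix i assume "Suc i < length (y # bs)"
      then show "E ((y # bs) ! i) ((y # bs) ! Suc i)"
        using xs(1) unfolding is_walk_def ab
        by (auto simp: nth_append dest!: spec[of _ "length as + i"])
    qed simp
    then show ?thesis using xs ab by (intro exI[of _ "y # bs"]) auto
  next
    case False
    have "is_walk E (y # xs)"
      unfolding is_walk_def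
    proof (intro conjI allI impI)
      fix i assume i: "Suc i < length (y # xs)"
      show "E ((y # xs) ! i) ((y # xs) ! Suc i)"
      proof (cases i)
        case 0
        then show ?thesis using step(1) xs(1,3) by (auto simp: is_walk_def hd_conv_nth)
      next
        case (Suc j)
        then show ?thesis using i xs(1) by (auto simp: is_walk_def)
      qed
    qed simp
    then show ?thesis using xs False by (intro exI[of _ "y # xs"]) (auto simp: is_walk_def)
  qed
qed

locale tree_graph =
  fixes V :: "'a set" and E :: "'a \<Rightarrow> 'a \<Rightarrow> bool"
  assumes tree: "is_tree V E"
begin

lemma finite_V: "finite V"
  and edge_in: "E x y \<Longrightarrow> x \<in> V \<and> y \<in> V"
  and edge_sym: "E x y \<Longrightarrow> E y x"
  and edge_irrefl: "\<not> E x x"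
  using tree by (auto simp: is_tree_def simple_graph_def)

lemma relpowp_sym: "(E ^^ n) u v \<Longrightarrow> (E ^^ n) v u"
proof (induction n arbitrary: v)
  case (Suc n)
  then obtain z where "(E ^^ n) u z" "E z v" by (auto elim: relpowp_Suc_E)
  then show ?case using Suc.IH edge_sym by (blast intro: relpowp_Suc_I2)
qed auto

text \<open>Connectedness provides some walk, so the \<open>LEAST\<close> behind
  \<open>gdist\<close> is attained.\<close>

lemma relpowp_gdist:
  assumes "u \<in> V" "v \<in> V"
  shows "(E ^^ gdist E u v) u v"
proof -
  obtain xs where xs: "is_walk E xs" "hd xs = u" "last xs = v"
    using tree assms unfolding is_tree_def connected_graph_def by blast
  then have "length xs = Suc (length xs - 1)" by (cases xs) (auto simp: is_walk_def)
  then have "(E ^^ (length xs - 1)) u v"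
    using xs walk_iff_relpowp[of E u v "length xs - 1"] by blast
  then show ?thesis unfolding gdist_eq_Least by (rule LeastI)
qed

lemma gdist_le: "(E ^^ n) u v \<Longrightarrow> gdist E u v \<le> n"
  unfolding gdist_eq_Least by (rule Least_le)

lemma gdist_self [simp]: "gdist E u u = 0"
  using gdist_le[of 0 u u] by simp

lemma gdist_eq_0_iff: "u \<in> V \<Longrightarrow> v \<in> V \<Longrightarrow> gdist E u v = 0 \<longleftrightarrow> u = v"
  using relpowp_gdist[of u v] by auto

lemma gdist_sym: "u \<in> V \<Longrightarrow> v \<in> V \<Longrightarrow> gdist E u v = gdist E v u"
  by (meson gdist_le le_antisym relpowp_gdist relpowp_sym)

lemma gdist_triangle:
  assumes "u \<in> V" "v \<in> V" "z \<in> V"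
  shows "gdist E u z \<le> gdist E u v + gdist E v z"
proof (rule gdist_le)
  show "(E ^^ (gdist E u v + gdist E v z)) u z"
    unfolding relpowp_add using relpowp_gdist assms by blast
qed

lemma gdist_edge_le: "E u v \<Longrightarrow> gdist E u v \<le> 1"
  by (rule gdist_le) auto

lemma gdist_SucE:
  assumes "u \<in> V" "v \<in> V" "gdist E u v = Suc n"
  obtains v' where "E v' v" "v' \<in> V" "gdist E u v' = n"
proof -
  have "(E ^^ Suc n) u v" using relpowp_gdist[OF assms(1,2)] assms(3) by simp
  then obtain v' where v': "(E ^^ n) u v'" "E v' v" by (rule relpowp_Suc_E)
  have "v' \<in> V" using edge_in v'(2) by blast
  moreover have "gdist E u v' = n"
    using gdist_le[OF v'(1)] gdist_triangle[of u v' v] gdist_edge_le[OF v'(2)] assms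
      \<open>v' \<in> V\<close> by linarith
  ultimately show thesis using that v'(2) by blast
qed

text \<open>Picks the vertex at a prescribed position on a shortest walk; this later yields the
  centre of a longest path.\<close>

lemma gdist_split:
  assumes "u \<in> V" "v \<in> V" "gdist E u v = m + n"
  obtains z where "z \<in> V" "gdist E u z = m" "gdist E z v = n"
proof -
  have "\<exists>z\<in>V. gdist E u z = m \<and> gdist E z v = n"
    using assms(2,3)
  proof (induction n arbitrary: v)
    case 0
    then show ?case by auto
  next
    case (Suc n)
    obtain v' where v': "E v' v" "v' \<in> V" "gdist E u v' = m + n"
      using gdist_SucE[of u v "m + n"] assms(1) Suc.prems by auto
    then obtain z where z: "z \<in> V" "gdist E u z = m" "gdist E z v' = n"
      using Suc.IH by blast
    have "gdist E z v \<le> Suc n"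
      using gdist_triangle[of z v' v] gdist_edge_le[OF v'(1)] z v' Suc.prems by simp
    moreover have "m + Suc n \<le> m + gdist E z v"
      using gdist_triangle[of u z v] z assms(1) Suc.prems by simp
    ultimately show ?case using z by (intro bexI[of _ z]) auto
  qed
  then show thesis using that by blast
qed

text \<open>Acyclicity enters here: two different neighbours of \<open>x\<close> joined by a walk
  avoiding \<open>x\<close> would close up through \<open>x\<close> to a cycle.\<close>

lemma neighbours_eq_if_linked:
  assumes "E x y" "E x z" "(\<lambda>s t. E s t \<and> s \<noteq> x \<and> t \<noteq> x)\<^sup>*\<^sup>* y z"
  shows "y = z"
proof (rule ccontr)
  assume neq: "y \<noteq> z"
  let ?F = "\<lambda>s t. E s t \<and> s \<noteq> x \<and> t \<noteq> x"
  obtain xs where xs: "is_walk ?F xs" "distinct xs" "hd xs = y" "last xs = z"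
    using rtranclp_imp_distinct_walk[OF assms(3)] by blast
  have ne: "xs \<noteq> []" using xs(1) by (simp add: is_walk_def)
  \<comment> \<open>The ends \<open>y\<close> and \<open>z\<close> differ, so adding
    \<open>x\<close> gives the three vertices that a cycle requires.\<close>
  have len: "2 \<le> length xs"
  proof (rule ccontr)
    assume "\<not> 2 \<le> length xs"
    then obtain t where "xs = [t]" using ne by (cases xs) (auto simp: Suc_le_eq)
    then show False using xs neq by simp
  qed
  have F: "?F (xs ! i) (xs ! Suc i)" if "Suc i < length xs" for i
    using xs(1) that unfolding is_walk_def by blast
  have el: "xs ! i \<noteq> x \<and> xs ! i \<in> V" if i: "i < length xs" for i
  proof (cases i)
    case 0
    then show ?thesis using F[of 0] len edge_in by fastforce
  next
    case (Suc j)
    then show ?thesis using F[of j] i edge_in by blast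
  qed
  have "is_walk E (x # xs)"
    unfolding is_walk_def
  proof (intro conjI allI impI)
    fix i assume i: "Suc i < length (x # xs)"
    show "E ((x # xs) ! i) ((x # xs) ! Suc i)"
      using i F assms(1) xs(3) ne by (cases i) (auto simp: hd_conv_nth)
  qed simp
  moreover have "distinct (x # xs)" "set (x # xs) \<subseteq> V"
    using el xs(2) assms(1) edge_in by (auto simp: in_set_conv_nth)
  moreover have "E (last (x # xs)) (hd (x # xs))"
    using ne xs(4) assms(2) edge_sym by auto
  moreover have "3 \<le> length (x # xs)" using len by simp
  ultimately have "has_cycle V E" unfolding has_cycle_def by blast
  then show False using tree by (simp add: is_tree_def)
qed

end

section \<open>Rooted trees\<close>

locale rooted_tree = tree_graph +
  fixes c :: 'a
  assumes root_in: "c \<in> V"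
begin

definition depth :: "'a \<Rightarrow> nat" where
  "depth x = gdist E c x"

text \<open>The comparison of depths is not strict, so uniqueness of this neighbour also excludes
  edges between vertices of equal depth. The root is its own parent, which lets
  \<open>parent\<close> be iterated freely.\<close>

definition parent :: "'a \<Rightarrow> 'a" where
  "parent x = (if x = c then c else (THE y. E x y \<and> depth y \<le> depth x))"

lemma depth_root [simp]: "depth c = 0"
  by (simp add: depth_def)

lemma depth_eq_0_iff: "x \<in> V \<Longrightarrow> depth x = 0 \<longleftrightarrow> x = c"
  unfolding depth_def using gdist_eq_0_iff[OF root_in] by auto

text \<open>Follow a shortest walk to the root: after the first step the depth is below
  \<open>depth x\<close>, so \<open>x\<close> is never met.\<close>

lemma linked_to_root:
  assumes "y \<in> V" "y \<noteq> x" "depth y \<le> depth x"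
  shows "(\<lambda>s t. E s t \<and> s \<noteq> x \<and> t \<noteq> x)\<^sup>*\<^sup>* y c"
  using assms
proof (induction "depth y" arbitrary: y)
  case 0
  then show ?case using depth_eq_0_iff by auto
next
  case (Suc n)
  obtain z where z: "E z y" "z \<in> V" "depth z = n"
    using gdist_SucE[of c y n] Suc root_in unfolding depth_def by metis
  then have "z \<noteq> x" using Suc by auto
  then have "(\<lambda>s t. E s t \<and> s \<noteq> x \<and> t \<noteq> x)\<^sup>*\<^sup>* z c" using Suc z by auto
  moreover have "E y z \<and> y \<noteq> x \<and> z \<noteq> x" using z Suc \<open>z \<noteq> x\<close> edge_sym by blast
  ultimately show ?case by (rule converse_rtranclp_into_rtranclp[rotated])
qed

text \<open>Both neighbours reach the root while avoiding \<open>x\<close>, so they are linked to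
  each other avoiding \<open>x\<close>.\<close>

lemma upper_neighbour_unique:
  assumes "E x y" "E x z" "depth y \<le> depth x" "depth z \<le> depth x"
  shows "y = z"
proof -
  let ?F = "\<lambda>s t. E s t \<and> s \<noteq> x \<and> t \<noteq> x"
  have "y \<in> V" "z \<in> V" "y \<noteq> x" "z \<noteq> x" using assms(1,2) edge_in edge_irrefl by blast+
  then have yc: "?F\<^sup>*\<^sup>* y c" and zc: "?F\<^sup>*\<^sup>* z c"
    using linked_to_root assms(3,4) by auto
  have "symp ?F" using edge_sym by (intro sympI) simp
  then have "?F\<^sup>*\<^sup>* c z" using zc by (rule sympD[OF symp_rtranclp])
  with yc have "?F\<^sup>*\<^sup>* y z" by (rule rtranclp_trans)
  with assms(1,2) show ?thesis by (rule neighbours_eq_if_linked)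
qed

lemma parent_edge:
  assumes "x \<in> V" "x \<noteq> c"
  shows "E x (parent x)" "Suc (depth (parent x)) = depth x"
proof -
  obtain n where n: "depth x = Suc n" using assms depth_eq_0_iff[of x] by (cases "depth x") auto
  then obtain z where z: "E z x" "z \<in> V" "depth z = n"
    using gdist_SucE[of c x n] assms root_in unfolding depth_def by metis
  have "(THE y. E x y \<and> depth y \<le> depth x) = z"
  proof (rule the_equality)
    show "E x z \<and> depth z \<le> depth x" using z n edge_sym by simp
    show "y = z" if "E x y \<and> depth y \<le> depth x" for y
      using upper_neighbour_unique[of x y z] that z n edge_sym by simp
  qed
  then have "parent x = z" using assms by (simp add: parent_def)
  then show "E x (parent x)" "Suc (depth (parent x)) = depth x" using z n edge_sym by auto
qed

lemma parent_root [simp]: "parent c = c"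
  by (simp add: parent_def)

lemma parent_in: "x \<in> V \<Longrightarrow> parent x \<in> V"
  using parent_edge(1)[of x] edge_in root_in by (cases "x = c") auto

lemma depth_parent: "x \<in> V \<Longrightarrow> depth (parent x) = depth x - 1"
  using parent_edge(2)[of x] by (cases "x = c") auto

text \<open>The shallower end of an edge is an upper neighbour of the other end, hence its parent.
  The tree is thus encoded by its parent map.\<close>

lemma edge_iff_parent:
  "E x y \<longleftrightarrow> x \<in> V \<and> y \<in> V \<and> (x \<noteq> c \<and> y = parent x \<or> y \<noteq> c \<and> x = parent y)"
proof -
  have aux: "s \<noteq> c \<and> t = parent s" if st: "E s t" "depth t \<le> depth s" for s t
  proof -
    have "s \<in> V" "t \<in> V" using st edge_in by blast+
    have "s \<noteq> c" using st depth_eq_0_iff[of t] \<open>t \<in> V\<close> edge_irrefl by auto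
    moreover from this have "t = parent s"
      using upper_neighbour_unique[of s t "parent s"] parent_edge[of s] st \<open>s \<in> V\<close> by simp
    ultimately show ?thesis by blast
  qed
  show ?thesis
  proof
    assume e: "E x y"
    then have "E y x" by (rule edge_sym)
    then show "x \<in> V \<and> y \<in> V \<and> (x \<noteq> c \<and> y = parent x \<or> y \<noteq> c \<and> x = parent y)"
      using aux[of x y] aux[of y x] e edge_in[OF e] nat_le_linear[of "depth x" "depth y"] by blast
  qed (use parent_edge(1) edge_sym in blast)
qed

section \<open>Ancestors in a rooted tree\<close>

definition anc :: "'a \<Rightarrow> 'a \<Rightarrow> bool" where
  "anc x y \<longleftrightarrow> (\<exists>n. x = (parent ^^ n) y)"

lemma anc_refl [simp]: "anc x x"
  unfolding anc_def by (rule exI[of _ 0]) simp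

lemma anc_trans: "anc x y \<Longrightarrow> anc y z \<Longrightarrow> anc x z"
  unfolding anc_def by (metis comp_apply funpow_add)

lemma anc_parent [simp]: "anc (parent x) x"
  unfolding anc_def by (rule exI[of _ 1]) simp

lemma anc_iff: "anc x y \<longleftrightarrow> x = y \<or> anc x (parent y)"
proof
  assume "anc x y"
  then obtain n where "x = (parent ^^ n) y" unfolding anc_def by blast
  then show "x = y \<or> anc x (parent y)"
    by (cases n) (auto simp: anc_def funpow_swap1)
qed (auto intro: anc_trans)

lemma funpow_parent_in: "y \<in> V \<Longrightarrow> (parent ^^ n) y \<in> V"
  by (induction n) (auto simp: parent_in)

lemma depth_funpow_parent: "y \<in> V \<Longrightarrow> depth ((parent ^^ n) y) = depth y - n"
  by (induction n) (auto simp: depth_parent funpow_parent_in)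

lemma anc_in: "anc x y \<Longrightarrow> y \<in> V \<Longrightarrow> x \<in> V"
  unfolding anc_def using funpow_parent_in by blast

lemma anc_depth_le: "anc x y \<Longrightarrow> y \<in> V \<Longrightarrow> depth x \<le> depth y"
  unfolding anc_def using depth_funpow_parent by auto

lemma anc_root: "y \<in> V \<Longrightarrow> anc c y"
  unfolding anc_def using depth_funpow_parent[of y "depth y"] depth_eq_0_iff funpow_parent_in
  by (metis diff_self_eq_0)

lemma anc_chain:
  assumes "anc x z" "anc y z" "z \<in> V" "depth x \<le> depth y"
  shows "anc x y"
proof -
  obtain m n where mn: "x = (parent ^^ m) z" "y = (parent ^^ n) z"
    using assms unfolding anc_def by blast
  show ?thesis
  proof (cases "n \<le> m")
    case True
    then have "x = (parent ^^ (m - n)) y"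
      using mn by (metis comp_apply funpow_add le_add_diff_inverse2)
    then show ?thesis unfolding anc_def by blast
  next
    case False
    \<comment> \<open>Here \<open>m < n\<close>, and \<open>depth z - m \<le> depth z - n\<close>
      can then hold only because the subtraction is truncated at the root.\<close>
    then have "depth x = 0" using mn assms depth_funpow_parent by auto
    then have "x = c" using depth_eq_0_iff anc_in assms by blast
    then show ?thesis using anc_root anc_in assms by blast
  qed
qed

lemma anc_same_depth:
  assumes "anc x y" "y \<in> V" "depth x = depth y"
  shows "x = y"
proof -
  obtain n where n: "x = (parent ^^ n) y" using assms unfolding anc_def by blast
  then have "depth y = depth y - n" using assms depth_funpow_parent by metis
  then have "n = 0 \<or> depth y = 0" by linarith
  then show ?thesis using n assms depth_eq_0_iff anc_in by (metis funpow_0)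
qed

lemma anc_eqI:
  "anc x z \<Longrightarrow> anc y z \<Longrightarrow> z \<in> V \<Longrightarrow> depth x = depth y \<Longrightarrow> x = y"
  using anc_chain anc_same_depth anc_in by (metis order_refl)

lemma anc_of_depth:
  assumes "y \<in> V" "i \<le> depth y"
  obtains x where "anc x y" "depth x = i"
proof -
  have "anc ((parent ^^ (depth y - i)) y) y" unfolding anc_def by blast
  then show thesis using that depth_funpow_parent[of y "depth y - i"] assms by simp
qed

lemma gdist_anc_le: "y \<in> V \<Longrightarrow> anc x y \<Longrightarrow> gdist E x y + depth x \<le> depth y"
proof -
  assume y: "y \<in> V" and "anc x y"
  then obtain n where n: "x = (parent ^^ n) y" unfolding anc_def by blast
  have "gdist E ((parent ^^ n) y) y + depth ((parent ^^ n) y) \<le> depth y"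
  proof (induction n)
    case (Suc n)
    let ?z = "(parent ^^ n) y"
    have z: "?z \<in> V" using y funpow_parent_in by blast
    show ?case
    proof (cases "?z = c")
      case False
      then have "E (parent ?z) ?z" "Suc (depth (parent ?z)) = depth ?z"
        using parent_edge z edge_sym by auto
      then show ?thesis
        using Suc gdist_triangle[of "parent ?z" ?z y] gdist_edge_le parent_in z y by fastforce
    qed (use Suc in auto)
  qed simp
  then show ?thesis using n by simp
qed

section \<open>Distances through the deepest common ancestor\<close>

definition meet_depth :: "'a \<Rightarrow> 'a \<Rightarrow> nat" where
  "meet_depth y z = Max (depth ` {m. anc m y \<and> anc m z})"

lemma finite_common: "y \<in> V \<Longrightarrow> finite {m. anc m y \<and> anc m z}"
  using finite_subset[OF _ finite_V] anc_in by (metis (no_types, lifting) mem_Collect_eq subsetI)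

lemma meet_depth_ge: "y \<in> V \<Longrightarrow> anc m y \<Longrightarrow> anc m z \<Longrightarrow> depth m \<le> meet_depth y z"
  unfolding meet_depth_def using finite_common by (intro Max_ge) auto

lemma meet_depthE:
  assumes "y \<in> V" "z \<in> V"
  obtains m where "anc m y" "anc m z" "depth m = meet_depth y z"
proof -
  have "meet_depth y z \<in> depth ` {m. anc m y \<and> anc m z}"
    unfolding meet_depth_def using finite_common assms anc_root by (intro Max_in) auto
  then show thesis using that by auto
qed

text \<open>Induction along the walk. A step down raises \<open>depth z\<close> by one and keeps the
  common ancestors; a step up lowers \<open>depth z\<close> by one and the meeting depth by at most
  one, namely when it leaves the meeting vertex itself.\<close>

lemma depth_sum_le_walk:
  assumes "y \<in> V" "(E ^^ n) y z"
  shows "depth y + depth z \<le> n + 2 * meet_depth y z"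
  using assms(2)
proof (induction n arbitrary: z)
  case 0
  then show ?case using assms(1) meet_depth_ge[of y y y] by simp
next
  case (Suc n)
  then obtain z' where z': "(E ^^ n) y z'" "E z' z" by (auto elim: relpowp_Suc_E)
  have in_V: "z \<in> V" "z' \<in> V" using z' edge_in by blast+
  have IH: "depth y + depth z' \<le> n + 2 * meet_depth y z'" using Suc.IH z' by blast
  obtain m where m: "anc m y" "anc m z'" "depth m = meet_depth y z'"
    using meet_depthE assms(1) in_V by blast
  consider "z \<noteq> c" "z' = parent z" | "z' \<noteq> c" "z = parent z'"
    using z'(2) edge_iff_parent by blast
  then show ?case
  proof cases
    case 1
    then have "anc m z" using m anc_trans anc_parent by blast
    then have "meet_depth y z' \<le> meet_depth y z"
      using meet_depth_ge[of y m z] m assms(1) by simp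
    moreover have "Suc (depth z') = depth z" using parent_edge 1 in_V by blast
    ultimately show ?thesis using IH by simp
  next
    case 2
    then have d: "Suc (depth z) = depth z'" using parent_edge in_V by blast
    show ?thesis
    proof (cases "m = z'")
      case True
      then have "anc z y" using 2 m anc_trans anc_parent by blast
      then have "depth z \<le> meet_depth y z" using meet_depth_ge assms(1) by simp
      then show ?thesis using IH d m True by simp
    next
      case False
      then have "anc m z" using m 2 anc_iff by blast
      then have "meet_depth y z' \<le> meet_depth y z"
        using meet_depth_ge[of y m z] m assms(1) by simp
      then show ?thesis using IH d by simp
    qed
  qed
qed

text \<open>The lower bound is the walk estimate, the upper bound the route via the deepest common
  ancestor. The additive form avoids truncated subtraction.\<close>

lemma gdist_meet:
  assumes "y \<in> V" "z \<in> V"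
  shows "gdist E y z + 2 * meet_depth y z = depth y + depth z"
proof (rule antisym)
  show "depth y + depth z \<le> gdist E y z + 2 * meet_depth y z"
    using depth_sum_le_walk relpowp_gdist assms by blast
  obtain m where m: "anc m y" "anc m z" "depth m = meet_depth y z"
    using meet_depthE assms by blast
  have "gdist E m y + depth m \<le> depth y" "gdist E m z + depth m \<le> depth z"
    using gdist_anc_le m assms by blast+
  moreover have "gdist E y z \<le> gdist E m y + gdist E m z"
    using gdist_triangle[of y m z] gdist_sym[of y m] anc_in m assms by metis
  ultimately show "gdist E y z + 2 * meet_depth y z \<le> depth y + depth z"
    using m by simp
qed

text \<open>By \<open>gdist_meet\<close> only depths and common ancestors matter. Used to show that
  a landmark cannot separate two vertices.\<close>

lemma gdist_cong_anc:
  assumes "y \<in> V" "y' \<in> V" "z \<in> V" "depth y = depth y'"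
    and "\<And>m. anc m z \<Longrightarrow> anc m y \<longleftrightarrow> anc m y'"
  shows "gdist E z y = gdist E z y'"
proof -
  have "{m. anc m z \<and> anc m y} = {m. anc m z \<and> anc m y'}" using assms(5) by blast
  then have "meet_depth z y = meet_depth z y'" by (simp add: meet_depth_def)
  then show ?thesis using gdist_meet[of z y] gdist_meet[of z y'] assms by simp
qed

lemma gdist_through_root:
  assumes "y \<in> V" "z \<in> V" "\<And>m. anc m y \<Longrightarrow> anc m z \<Longrightarrow> m = c"
  shows "gdist E y z = depth y + depth z"
  using meet_depthE[OF assms(1,2)] assms(3) gdist_meet[OF assms(1,2)]
  by (metis add.right_neutral depth_root mult_zero_right)


lemma common_anc_root:
  assumes "y \<in> V" "z \<in> V" "gdist E y z = depth y + depth z" "anc m y" "anc m z"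
  shows "m = c"
  using gdist_meet[OF assms(1,2)] meet_depth_ge[OF assms(1,4,5)] assms(1,3,4)
    depth_eq_0_iff[of m] anc_in[of m y] by simp

lemma anc_of_root [simp]: "anc m c \<longleftrightarrow> m = c"
  using anc_depth_le[of m c] anc_in[of m c] depth_eq_0_iff root_in by auto

end

section \<open>A common description of the hairy spiders\<close>

text \<open>Edges of the hairy spiders join a vertex to its parent, the tree being rooted at
  \<open>(0, 0, 0)\<close>. The flag \<open>two\<close> says whether there is a second centre \<open>(0, 0, 1)\<close>.\<close>

definition spider_V :: "bool \<Rightarrow> nat \<Rightarrow> nat \<Rightarrow> (nat \<times> nat \<times> nat) set" where
  "spider_V two k r =
     {(q, i, j). q < k \<and> 0 < i \<and> i + j \<le> r} \<union>
     {(q, i, j). (q = k \<or> two \<and> q = Suc k) \<and> 0 < i \<and> i \<le> r \<and> j = 0} \<union>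
     {(0, 0, 0)} \<union> (if two then {(0, 0, 1)} else {})"

text \<open>For \<open>i = 0\<close> the second centre is sent to the first, which is fixed. The
  spider with a single centre is used with \<open>a = k\<close>, so its legs never reach the last
  branch.\<close>

definition spider_parent :: "nat \<Rightarrow> nat \<Rightarrow> nat \<times> nat \<times> nat \<Rightarrow> nat \<times> nat \<times> nat" where
  "spider_parent a k v = (case v of (q, i, j) \<Rightarrow>
     if i = 0 then (0, 0, 0)
     else if 0 < j then (q, i, j - 1)
     else if 1 < i then (q, i - 1, 0)
     else if q < a \<or> q = k then (0, 0, 0) else (0, 0, 1))"

definition spider_E ::
  "bool \<Rightarrow> nat \<Rightarrow> nat \<Rightarrow> nat \<Rightarrow> nat \<times> nat \<times> nat \<Rightarrow> nat \<times> nat \<times> nat \<Rightarrow> bool" where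
  "spider_E two a k r x y \<longleftrightarrow> x \<in> spider_V two k r \<and> y \<in> spider_V two k r \<and>
     (x \<noteq> (0, 0, 0) \<and> y = spider_parent a k x \<or> y \<noteq> (0, 0, 0) \<and> x = spider_parent a k y)"

text \<open>A bare leg together with its centre has \<open>r + 1\<close> vertices, and a copy of
  \<open>L_r\<close> without its root has half of \<open>r * (r + 1)\<close>; doubling avoids the
  division.\<close>

lemma card_spider_V:
  "2 * card (spider_V two k r) = (if two then 2 else 1) * (2 * (r + 1)) + k * (r * (r + 1))"
proof -
  let ?T = "SIGMA i:{1..r}. {..r - i}"
  let ?A = "{..<k} \<times> ?T"
  let ?B = "(if two then {k, Suc k} else {k}) \<times> {1..r} \<times> {0 :: nat}"
  let ?C = "{0 :: nat} \<times> {0 :: nat} \<times> (if two then {0, 1} else {0 :: nat})"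
  have "spider_V two k r = ?A \<union> ?B \<union> ?C"
    by (auto simp: spider_V_def)
  moreover have "card (?A \<union> ?B \<union> ?C) = card ?A + card ?B + card ?C"
    by (subst card_Un_disjoint; (subst card_Un_disjoint)?) (auto split: if_splits)
  moreover have "2 * card ?T = r * (r + 1)"
  proof -
    have "card ?T = (\<Sum>i = 1..r. Suc (r - i))" by simp
    also have "\<dots> = (\<Sum>i = 1..r. i)"
      by (subst sum.atLeastAtMost_rev) (auto intro: sum.cong)
    finally show ?thesis
      using gauss_sum_from_Suc_0[of r, where 'a = nat] by simp
  qed
  ultimately show ?thesis by (auto simp: card_cartesian_product algebra_simps)
qed

lemma HS_even_V_eq: "HS_even_V d k = spider_V False k (d div 2)"
proof (intro set_eqI iffI)
  fix x assume "x \<in> HS_even_V d k"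
  then show "x \<in> spider_V False k (d div 2)"
    by (auto simp: HS_even_V_def HSe_raw_V_def HSe_norm_def L_verts_def P_verts_def spider_V_def
        split: if_splits)
next
  fix x assume x: "x \<in> spider_V False k (d div 2)"
  then have "x \<in> HSe_raw_V d k \<and> HSe_norm x = x \<or> x = HSe_norm (k, 0, 0)"
    by (auto simp: HSe_raw_V_def HSe_norm_def L_verts_def P_verts_def spider_V_def)
  moreover have "(k, 0, 0) \<in> HSe_raw_V d k"
    by (auto simp: HSe_raw_V_def P_verts_def)
  ultimately show "x \<in> HS_even_V d k"
    unfolding HS_even_V_def by (metis image_eqI)
qed

lemma HS_odd_V_eq:
  assumes "a \<le> k"
  shows "HS_odd_V d k a = spider_V True k ((d - 1) div 2)"
proof (intro set_eqI iffI)
  fix x assume "x \<in> HS_odd_V d k a"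
  then show "x \<in> spider_V True k ((d - 1) div 2)"
    by (auto simp: HS_odd_V_def HSo_raw_V_def HSo_norm_def L_verts_def P_verts_def spider_V_def
        split: if_splits)
next
  fix x assume x: "x \<in> spider_V True k ((d - 1) div 2)"
  \<comment> \<open>The roots of the two bare paths represent the two centres;
    \<open>a \<le> k\<close> keeps copy \<open>Suc k\<close> on the second side.\<close>
  then have "x \<in> HSo_raw_V d k \<and> HSo_norm k a x = x \<or>
      x = HSo_norm k a (k, 0, 0) \<or> x = HSo_norm k a (Suc k, 0, 0)"
    using assms by (auto simp: HSo_raw_V_def HSo_norm_def L_verts_def P_verts_def spider_V_def)
  moreover have "(k, 0, 0) \<in> HSo_raw_V d k" "(Suc k, 0, 0) \<in> HSo_raw_V d k"
    by (auto simp: HSo_raw_V_def P_verts_def)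
  ultimately show "x \<in> HS_odd_V d k a"
    unfolding HS_odd_V_def by (metis image_eqI)
qed

text \<open>The parent inside one copy, before roots are identified. Away from the centres,
  \<open>spider_parent\<close> is its normalisation.\<close>

definition raw_parent :: "nat \<times> nat \<times> nat \<Rightarrow> nat \<times> nat \<times> nat" where
  "raw_parent v = (case v of (q, i, j) \<Rightarrow> if 0 < j then (q, i, j - 1) else (q, i - 1, 0))"

lemma HSe_raw_E_iff:
  assumes "p \<in> HSe_raw_V d k" "q \<in> HSe_raw_V d k"
  shows "HSe_raw_E d k p q \<longleftrightarrow> fst (snd q) \<noteq> 0 \<and> p = raw_parent q"
  using assms
  by (cases p; cases q)
    (auto simp: HSe_raw_V_def HSe_raw_E_def L_verts_def L_edge_def P_verts_def P_edge_def
      raw_parent_def split: if_splits)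

lemma HSo_raw_E_iff:
  assumes "p \<in> HSo_raw_V d k" "q \<in> HSo_raw_V d k"
  shows "HSo_raw_E d k p q \<longleftrightarrow> fst (snd q) \<noteq> 0 \<and> p = raw_parent q"
  using assms
  by (cases p; cases q)
    (auto simp: HSo_raw_V_def HSo_raw_E_def L_verts_def L_edge_def P_verts_def P_edge_def
      raw_parent_def split: if_splits)

text \<open>Normalisation moves only roots, so the lower end of a raw edge represents itself and
  only its parent has to be normalised.\<close>

lemma HS_even_E_eq: "HS_even_E d k = spider_E False k k (d div 2)"
proof (intro ext)
  fix x y
  let ?V = "HSe_raw_V d k" and ?S = "spider_V False k (d div 2)"
  have raw: "(\<exists>p q. p \<in> ?V \<and> q \<in> ?V \<and> HSe_raw_E d k p q \<and> x = HSe_norm p \<and> y = HSe_norm q)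
      \<longleftrightarrow> x \<in> ?S \<and> y \<in> ?S \<and> y \<noteq> (0, 0, 0) \<and> x = spider_parent k k y" (is "?l \<longleftrightarrow> ?r") for x y
  proof
    assume ?l
    then obtain p q where pq: "p \<in> ?V" "q \<in> ?V" "HSe_raw_E d k p q" "x = HSe_norm p"
      "y = HSe_norm q" by blast
    then have "x \<in> ?S" "y \<in> ?S" unfolding HS_even_V_eq[symmetric] HS_even_V_def by auto
    moreover have "fst (snd q) \<noteq> 0" "p = raw_parent q" using pq HSe_raw_E_iff by auto
    moreover have "y \<noteq> (0, 0, 0) \<and> x = spider_parent k k y"
      using calculation(3,4) pq(2,4,5)
      by (cases q) (auto simp: HSe_norm_def raw_parent_def spider_parent_def HSe_raw_V_def
          L_verts_def P_verts_def split: if_splits)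
    ultimately show ?r by blast
  next
    assume r: ?r
    obtain q i j where y: "y = (q, i, j)" by (metis prod_cases3)
    have "y \<in> ?S" "y \<noteq> (0, 0, 0)" using r by blast+
    then have in_V: "y \<in> ?V" "raw_parent y \<in> ?V" and "fst (snd y) \<noteq> 0"
      unfolding y
      by (auto simp: spider_V_def HSe_raw_V_def raw_parent_def L_verts_def P_verts_def)
    then have "HSe_raw_E d k (raw_parent y) y" using HSe_raw_E_iff by blast
    moreover have "y = HSe_norm y" "spider_parent k k y = HSe_norm (raw_parent y)"
      using \<open>y \<in> ?S\<close> \<open>fst (snd y) \<noteq> 0\<close> unfolding y
      by (auto simp: spider_V_def HSe_norm_def raw_parent_def spider_parent_def)
    ultimately show ?l using in_V r by (intro exI[of _ "raw_parent y"] exI[of _ y]) simp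
  qed
  show "HS_even_E d k x y = spider_E False k k (d div 2) x y"
    unfolding HS_even_E_def spider_E_def using raw[of x y] raw[of y x] by blast
qed

lemma HS_odd_E_eq:
  assumes "a \<le> k"
  shows "HS_odd_E d k a = spider_E True a k ((d - 1) div 2)"
proof (intro ext)
  fix x y
  let ?V = "HSo_raw_V d k" and ?S = "spider_V True k ((d - 1) div 2)"
  let ?n = "HSo_norm k a"
  have raw: "(\<exists>p q. p \<in> ?V \<and> q \<in> ?V \<and> HSo_raw_E d k p q \<and> x = ?n p \<and> y = ?n q)
      \<longleftrightarrow> x \<in> ?S \<and> y \<in> ?S \<and> fst (snd y) \<noteq> 0 \<and> x = spider_parent a k y" (is "?l \<longleftrightarrow> ?r") for x y
  proof
    assume ?l
    then obtain p q where pq: "p \<in> ?V" "q \<in> ?V" "HSo_raw_E d k p q" "x = ?n p" "y = ?n q"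
      by blast
    then have "x \<in> ?S" "y \<in> ?S"
      unfolding HS_odd_V_eq[OF assms, symmetric] HS_odd_V_def by auto
    moreover have "fst (snd q) \<noteq> 0" "p = raw_parent q" using pq HSo_raw_E_iff by auto
    moreover have "fst (snd y) \<noteq> 0 \<and> x = spider_parent a k y"
      using calculation(3,4) pq(2,4,5)
      by (cases q) (auto simp: HSo_norm_def raw_parent_def spider_parent_def HSo_raw_V_def
          L_verts_def P_verts_def split: if_splits)
    ultimately show ?r by blast
  next
    assume r: ?r
    obtain q i j where y: "y = (q, i, j)" by (metis prod_cases3)
    have "y \<in> ?S" "fst (snd y) \<noteq> 0" using r by blast+
    then have in_V: "y \<in> ?V" "raw_parent y \<in> ?V"
      unfolding y
      by (auto simp: spider_V_def HSo_raw_V_def raw_parent_def L_verts_def P_verts_def)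
    then have "HSo_raw_E d k (raw_parent y) y" using HSo_raw_E_iff r by blast
    moreover have "y = ?n y" "spider_parent a k y = ?n (raw_parent y)"
      using \<open>y \<in> ?S\<close> \<open>fst (snd y) \<noteq> 0\<close> assms unfolding y
      by (auto simp: spider_V_def HSo_norm_def raw_parent_def spider_parent_def split: if_splits)
    ultimately show ?l using in_V r by (intro exI[of _ "raw_parent y"] exI[of _ y]) simp
  qed
  have centre: "fst (snd y) = 0 \<longleftrightarrow> y = (0, 0, 0) \<or> y = (0, 0, 1)" if "y \<in> ?S" for y
    using that by (auto simp: spider_V_def)
  have "(0, 0, 0) \<in> ?S" "(0, 0, 1) \<in> ?S" "spider_parent a k (0, 0, 1) = (0, 0, 0)"
    by (auto simp: spider_V_def spider_parent_def)
  \<comment> \<open>The edge between the centres comes from no copy; it is split off the parent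
    relation to match the separate clause of \<open>HS_odd_E\<close>.\<close>
  then have root: "x \<in> ?S \<and> y \<in> ?S \<and> y \<noteq> (0, 0, 0) \<and> x = spider_parent a k y \<longleftrightarrow>
      (x \<in> ?S \<and> y \<in> ?S \<and> fst (snd y) \<noteq> 0 \<and> x = spider_parent a k y) \<or>
      x = (0, 0, 0) \<and> y = (0, 0, 1)" for x y
    using centre[of y] by (cases "y = (0, 0, 1)") auto
  have "HS_odd_E d k a x y \<longleftrightarrow>
      (x = (0, 0, 0) \<and> y = (0, 0, 1) \<or> y = (0, 0, 0) \<and> x = (0, 0, 1)) \<or>
      (\<exists>p q. p \<in> ?V \<and> q \<in> ?V \<and> HSo_raw_E d k p q \<and> x = ?n p \<and> y = ?n q) \<or>
      (\<exists>p q. p \<in> ?V \<and> q \<in> ?V \<and> HSo_raw_E d k p q \<and> y = ?n p \<and> x = ?n q)"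
    unfolding HS_odd_E_def by blast
  also have "\<dots> \<longleftrightarrow>
      (x \<in> ?S \<and> y \<in> ?S \<and> y \<noteq> (0, 0, 0) \<and> x = spider_parent a k y) \<or>
      (y \<in> ?S \<and> x \<in> ?S \<and> x \<noteq> (0, 0, 0) \<and> y = spider_parent a k x)"
    unfolding raw root by argo
  also have "\<dots> \<longleftrightarrow> spider_E True a k ((d - 1) div 2) x y"
    unfolding spider_E_def by argo
  finally show "HS_odd_E d k a x y = spider_E True a k ((d - 1) div 2) x y" .
qed

section \<open>Encoding a tree in a hairy spider\<close>

text \<open>Depth is measured from \<open>c\<close> on both sides, hence the bound
  \<open>Suc r\<close> below \<open>w\<close>. The numbering \<open>\<sigma>\<close> assigns legs to
  landmarks; those not below the second centre get numbers less than \<open>a\<close>, since these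
  legs hang at the first centre.\<close>

locale resolved_tree = rooted_tree V E c for V :: "'a set" and E c +
  fixes R :: "'a set" and w :: 'a and two :: bool and r k a :: nat and \<sigma> :: "'a \<Rightarrow> nat"
  assumes resolving: "resolving_set V E R"
    and second_centre: "two \<Longrightarrow> w \<in> V \<and> w \<noteq> c \<and> parent w = c"
    and depth_bound: "y \<in> V \<Longrightarrow> depth y \<le> (if two \<and> anc w y then Suc r else r)"
    and enum: "bij_betw \<sigma> R {..<k}"
    and a_le: "a \<le> k"
    and enum_side: "\<rho> \<in> R \<Longrightarrow> \<sigma> \<rho> < a \<longleftrightarrow> \<not> (two \<and> anc w \<rho>)"
begin

lemma R_in: "\<rho> \<in> R \<Longrightarrow> \<rho> \<in> V"
  using resolving unfolding resolving_set_def by blast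

lemma resolve:
  "y \<in> V \<Longrightarrow> z \<in> V \<Longrightarrow> (\<And>\<rho>. \<rho> \<in> R \<Longrightarrow> gdist E \<rho> y = gdist E \<rho> z) \<Longrightarrow> y = z"
  using resolving unfolding resolving_set_def by blast

text \<open>A number, so that it can correct depths in \<open>height\<close> and select the centre
  or the bare leg in \<open>code\<close>.\<close>

definition side :: "'a \<Rightarrow> nat" where
  "side y = (if two \<and> anc w y then 1 else 0)"

definition base :: "'a \<Rightarrow> 'a" where
  "base y = (if two \<and> anc w y then w else c)"

definition height :: "'a \<Rightarrow> nat" where
  "height y = depth y - side y"

lemma depth_w: "two \<Longrightarrow> depth w = 1"
  using second_centre parent_edge(2)[of w] by simp

lemma anc_base: "y \<in> V \<Longrightarrow> anc (base y) y"
  using anc_root by (simp add: base_def)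

lemma base_root: "base c = c"
  unfolding base_def using second_centre by auto

lemma base_w: "two \<Longrightarrow> base w = w"
  unfolding base_def by simp

lemma depth_base: "depth (base y) = side y"
  using depth_w by (simp add: base_def side_def)

lemma depth_eq: "y \<in> V \<Longrightarrow> depth y = height y + side y"
  using anc_depth_le[OF anc_base] depth_base by (simp add: height_def)

lemma height_le: "y \<in> V \<Longrightarrow> height y \<le> r"
  using depth_bound[of y] by (auto simp: height_def side_def split: if_splits)

lemma height_eq_0_iff: "y \<in> V \<Longrightarrow> height y = 0 \<longleftrightarrow> base y = y"
  using depth_eq depth_base anc_same_depth[OF anc_base]
  by (metis add.commute add_0 add_cancel_right_left)

text \<open>The root lies above both sides and is excluded. Any other ancestor is at least as deep
  as \<open>w\<close>, so if both lie above \<open>y\<close>, then \<open>w\<close> lies above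
  it.\<close>

lemma side_anc:
  assumes "anc x y" "y \<in> V" "x \<noteq> c"
  shows "side x = side y"
proof -
  have "anc w x \<longleftrightarrow> anc w y" if two
  proof
    assume "anc w y"
    moreover have "depth w \<le> depth x"
      using depth_w[OF that] depth_eq_0_iff[of x] assms anc_in by force
    ultimately show "anc w x" using anc_chain assms by blast
  qed (use anc_trans assms in blast)
  then show ?thesis by (auto simp: side_def)
qed

lemma base_eq_iff_side: "base x = base y \<longleftrightarrow> side x = side y"
  using second_centre by (auto simp: base_def side_def)

section \<open>The spine and the foot of a vertex on it\<close>

definition spine :: "'a set" where
  "spine = {x. \<exists>\<rho>\<in>R. anc x \<rho>} \<union> {c} \<union> (if two then {w} else {})"

lemma spine_in: "x \<in> spine \<Longrightarrow> x \<in> V"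
  using anc_in R_in root_in second_centre by (auto simp: spine_def split: if_splits)

lemma root_spine: "c \<in> spine"
  by (simp add: spine_def)

lemma w_spine: "two \<Longrightarrow> w \<in> spine"
  unfolding spine_def by simp

lemma base_spine: "base y \<in> spine"
  by (simp add: base_def spine_def)

lemma spine_anc:
  assumes "x \<in> spine" "anc m x"
  shows "m \<in> spine"
proof -
  have "m = w \<or> m = c" if "two" "anc m w"
    using that second_centre anc_iff[of m w] by auto
  then show ?thesis using assms anc_trans by (auto simp: spine_def split: if_splits)
qed

lemma spine_off_base: "x \<in> spine \<Longrightarrow> base x \<noteq> x \<Longrightarrow> \<exists>\<rho>\<in>R. anc x \<rho>"
  by (auto simp: spine_def base_def split: if_splits)

text \<open>The first spine vertex on the way up, equivalently the deepest spine ancestor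
  (\<open>anc_foot\<close>). It exists because the root is put into the spine even when
  \<open>R\<close> is empty.\<close>

definition foot :: "'a \<Rightarrow> 'a" where
  "foot y = (parent ^^ (LEAST n. (parent ^^ n) y \<in> spine)) y"

lemma foot_spine: "y \<in> V \<Longrightarrow> foot y \<in> spine"
  using anc_root[of y] root_spine unfolding foot_def anc_def by (metis (mono_tags) LeastI)

lemma foot_anc: "anc (foot y) y"
  unfolding foot_def anc_def by blast

lemma foot_in: "y \<in> V \<Longrightarrow> foot y \<in> V"
  using foot_spine spine_in by blast

lemma anc_foot:
  assumes "m \<in> spine" "anc m y"
  shows "anc m (foot y)"
proof -
  obtain n where n: "m = (parent ^^ n) y" using assms unfolding anc_def by blast
  let ?l = "LEAST n. (parent ^^ n) y \<in> spine"
  have "?l \<le> n" using n assms(1) by (auto intro: Least_le)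
  then have "m = (parent ^^ (n - ?l)) (foot y)"
    unfolding foot_def n by (metis comp_apply funpow_add le_add_diff_inverse2)
  then show ?thesis unfolding anc_def by blast
qed

lemma foot_unique:
  assumes "y \<in> V" "x \<in> spine" "anc x y" "\<And>m. m \<in> spine \<Longrightarrow> anc m y \<Longrightarrow> anc m x"
  shows "foot y = x"
proof -
  have "anc (foot y) x" "anc x (foot y)"
    using assms foot_spine foot_anc anc_foot by auto
  then have "depth (foot y) = depth x"
    using anc_depth_le foot_in assms(1,2) spine_in by (simp add: le_antisym)
  then show ?thesis using anc_same_depth \<open>anc (foot y) x\<close> spine_in assms(2) by blast
qed

lemma foot_of_spine: "y \<in> spine \<Longrightarrow> foot y = y"
  by (rule foot_unique) (auto simp: spine_in)

lemma foot_parent: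
  assumes "y \<in> V" "y \<notin> spine"
  shows "foot (parent y) = foot y"
proof (rule foot_unique)
  have "foot y \<noteq> y" using foot_spine assms by metis
  then show "anc (foot y) (parent y)" using foot_anc anc_iff by blast
  show "anc m (foot y)" if "m \<in> spine" "anc m (parent y)" for m
    using that anc_foot anc_parent anc_trans by blast
qed (use assms foot_spine parent_in in auto)

text \<open>Vertices with the same foot have the same common ancestors with each landmark.\<close>

lemma foot_depth_inj:
  assumes "y \<in> V" "z \<in> V" "foot y = foot z" "depth y = depth z"
  shows "y = z"
proof (rule resolve)
  fix \<rho> assume \<rho>: "\<rho> \<in> R"
  have "anc m y \<longleftrightarrow> anc m z" if "anc m \<rho>" for m
  proof -
    have "m \<in> spine" using that \<rho> by (auto simp: spine_def)
    then show ?thesis using anc_foot foot_anc anc_trans assms(3) by metis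
  qed
  then show "gdist E \<rho> y = gdist E \<rho> z"
    using gdist_cong_anc assms R_in \<rho> by blast
qed (use assms in auto)

text \<open>The critical case is a foot at the root: a vertex below \<open>w\<close> has its foot at
  or below \<open>w\<close>, since \<open>w\<close> is on the spine.\<close>

lemma side_foot:
  assumes "y \<in> V"
  shows "side (foot y) = side y"
proof (cases "foot y = c")
  case True
  have "\<not> anc w y" if two
  proof
    assume "anc w y"
    then have "anc w (foot y)" using anc_foot w_spine that by blast
    then show False using True second_centre that by simp
  qed
  moreover have "\<not> anc w c" if two using second_centre that by simp
  ultimately show ?thesis using True by (auto simp: side_def)
next
  case False
  then show ?thesis using side_anc foot_anc assms by blast
qed

section \<open>Coordinates of a vertex in the spider\<close>

definition tip :: "'a \<Rightarrow> 'a" where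
  "tip x = (SOME \<rho>. \<rho> \<in> R \<and> anc x \<rho>)"

text \<open>The landmark below a spine vertex is an arbitrary choice; it becomes forced in the case
  of equality.\<close>

lemma tip:
  assumes "x \<in> spine" "base x \<noteq> x"
  shows "tip x \<in> R" "anc x (tip x)"
  using someI_ex[of "\<lambda>\<rho>. \<rho> \<in> R \<and> anc x \<rho>"] spine_off_base[OF assms]
  unfolding tip_def by blast+

text \<open>A vertex whose foot is its own centre goes to that centre or to the bare leg there.
  Otherwise the foot is placed on the leg of its chosen landmark, and the third coordinate is the
  distance from the foot along the hair.\<close>

definition code :: "'a \<Rightarrow> nat \<times> nat \<times> nat" where
  "code y =
     (if foot y = base y
      then if height y = 0 then (0, 0, side y) else (k + side y, height y, 0)
      else (\<sigma> (tip (foot y)), height (foot y), height y - height (foot y)))"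

lemma base_foot: "y \<in> V \<Longrightarrow> base (foot y) = base y"
  using side_foot base_eq_iff_side by blast

lemma height_foot_le: "y \<in> V \<Longrightarrow> height (foot y) \<le> height y"
  using anc_depth_le[OF foot_anc] side_foot by (simp add: height_def diff_le_mono)

lemma tip_foot:
  assumes "y \<in> V" "foot y \<noteq> base y"
  shows "tip (foot y) \<in> R" "anc (foot y) (tip (foot y))" "\<sigma> (tip (foot y)) < k"
    "0 < height (foot y)" "side (tip (foot y)) = side y"
proof -
  have off: "base (foot y) \<noteq> foot y" using assms base_foot by metis
  show t: "tip (foot y) \<in> R" "anc (foot y) (tip (foot y))"
    using tip foot_spine off assms by auto
  show "\<sigma> (tip (foot y)) < k" using t enum by (auto simp: bij_betw_def)
  show "0 < height (foot y)" using off height_eq_0_iff foot_in assms by blast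
  have "foot y \<noteq> c" using off base_root by auto
  then have "side (foot y) = side (tip (foot y))" using side_anc t R_in by blast
  then show "side (tip (foot y)) = side y" using side_foot assms by simp
qed

lemma side_le: "side y \<le> (if two then 1 else 0)"
  by (simp add: side_def)

lemma code_in: "y \<in> V \<Longrightarrow> code y \<in> spider_V two k r"
  using tip_foot[of y] height_le[of y] height_foot_le[of y] side_le[of y]
  by (auto simp: code_def spider_V_def side_def)

text \<open>Landmark and height determine the foot as an ancestor of that landmark; foot and depth
  then determine the vertex.\<close>

lemma code_inj: "inj_on code V"
proof (rule inj_onI)
  fix y z assume yz: "y \<in> V" "z \<in> V" "code y = code z"
  show "y = z"
  proof (cases "foot y = base y")
    case True
    \<comment> \<open>The two clauses of \<open>code\<close> share no value: a landmark leg has a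
      number below \<open>k\<close> and positive height.\<close>
    then have z: "foot z = base z"
      using yz tip_foot[of z] by (auto simp: code_def split: if_splits)
    then have "side y = side z \<and> height y = height z"
      using True yz(3) by (auto simp: code_def split: if_splits)
    moreover from this have "foot y = foot z" using True z base_eq_iff_side by metis
    ultimately show ?thesis using foot_depth_inj depth_eq yz by metis
  next
    case False
    then have z: "foot z \<noteq> base z"
      using yz tip_foot[of y] by (auto simp: code_def split: if_splits)
    have eq: "\<sigma> (tip (foot y)) = \<sigma> (tip (foot z))" "height (foot y) = height (foot z)"
      "height y - height (foot y) = height z - height (foot z)"
      using yz(3) z False by (auto simp: code_def)
    have t: "tip (foot y) = tip (foot z)"
      using eq(1) enum tip_foot(1) yz z False by (auto simp: bij_betw_def inj_on_def)
    then have s: "side y = side z" using tip_foot(5) yz z False by metis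
    then have "depth (foot y) = depth (foot z)"
      using eq(2) depth_eq foot_in side_foot yz by simp
    then have "foot y = foot z"
      using anc_eqI tip_foot(1,2) yz z False t R_in by metis
    moreover have "height y = height z"
      using eq(2,3) height_foot_le yz by (metis le_add_diff_inverse)
    ultimately show ?thesis using foot_depth_inj depth_eq s yz by metis
  qed
qed

lemma finite_spider_V: "finite (spider_V two k r)"
proof (rule finite_subset)
  show "spider_V two k r \<subseteq> {..Suc k} \<times> {..r} \<times> {..Suc r}"
    by (auto simp: spider_V_def)
qed auto

lemma card_le: "card V \<le> card (spider_V two k r)"
  using code_inj code_in finite_spider_V by (meson card_inj_on_le image_subsetI)

section \<open>The case of equality\<close>

lemma code_surj:
  assumes "card V = card (spider_V two k r)"
  shows "code ` V = spider_V two k r"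
proof (rule card_subset_eq)
  show "card (code ` V) = card (spider_V two k r)" using assms code_inj by (simp add: card_image)
qed (use code_in finite_spider_V in auto)

lemma code_root: "code c = (0, 0, 0)"
proof -
  have "base c = c" "side c = 0" using second_centre by (auto simp: base_def side_def)
  then show ?thesis using foot_of_spine[OF root_spine] by (simp add: code_def height_def)
qed

text \<open>Surjectivity makes the spines of different landmarks meet in the centres only.\<close>

lemma tip_unique:
  assumes "code ` V = spider_V two k r" "\<rho> \<in> R" "anc x \<rho>" "base x \<noteq> x"
  shows "tip x = \<rho>"
proof -
  have x: "x \<in> spine" "x \<in> V" using assms R_in anc_in by (auto simp: spine_def)
  have "0 < height x" "height x \<le> r" using height_eq_0_iff height_le x assms by auto
  moreover have "\<sigma> \<rho> < k" using enum assms(2) by (auto simp: bij_betw_def)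
  \<comment> \<open>The place on the leg of \<open>\<rho>\<close> at the height of \<open>x\<close>
    must be filled. The foot of its preimage is an ancestor of \<open>\<rho>\<close> at the depth of
    \<open>x\<close>, hence \<open>x\<close> itself, and its tip is \<open>\<rho>\<close>.\<close>
  ultimately have "(\<sigma> \<rho>, height x, 0) \<in> spider_V two k r" by (simp add: spider_V_def)
  then obtain y where y: "y \<in> V" "code y = (\<sigma> \<rho>, height x, 0)" using assms(1) by (metis imageE)
  then have off: "foot y \<noteq> base y"
    using \<open>\<sigma> \<rho> < k\<close> \<open>0 < height x\<close> by (auto simp: code_def split: if_splits)
  then have "\<sigma> (tip (foot y)) = \<sigma> \<rho>" and h: "height (foot y) = height x"
    using y by (auto simp: code_def)
  then have t: "tip (foot y) = \<rho>"
    using enum tip_foot(1) y off assms(2) by (auto simp: bij_betw_def inj_on_def)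
  have "x \<noteq> c" using assms(4) base_root by auto
  then have "side x = side \<rho>" using side_anc assms R_in by blast
  then have "depth x = depth (foot y)"
    using t tip_foot(5)[OF y(1) off] depth_eq x foot_in y(1) h side_foot by simp
  then have "x = foot y"
    using anc_eqI assms(2,3) tip_foot(2)[OF y(1) off] R_in t by metis
  then show ?thesis using t by simp
qed

text \<open>Off the spine the parent keeps the foot and loses one unit of height. On the spine the
  parent must keep the chosen landmark, which is where surjectivity is needed.\<close>

lemma code_parent:
  assumes surj: "code ` V = spider_V two k r" and y: "y \<in> V" "y \<noteq> c"
  shows "code (parent y) = spider_parent a k (code y)"
proof -
  have py: "parent y \<in> V" "Suc (depth (parent y)) = depth y"
    using parent_in parent_edge y by auto
  show ?thesis
  proof (cases "base y = y")
    case True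
    then have "two \<and> y = w" using y by (auto simp: base_def split: if_splits)
    then have "parent y = c" using second_centre by simp
    moreover have "height y = 0" using height_eq_0_iff y True by simp
    moreover have "foot y = base y" using foot_of_spine base_spine True by metis
    ultimately show ?thesis using code_root by (simp add: code_def spider_parent_def)
  next
    case off: False
    then have hy: "0 < height y" using height_eq_0_iff[OF y(1)] by simp
    \<comment> \<open>Since the root has side 0, a child of the root must not lie below
      \<open>w\<close>. Only \<open>w\<close> itself does, and it is its own base.\<close>
    have side_p: "side (parent y) = side y"
    proof (cases "parent y = c")
      case True
      have "\<not> anc w y" if two
        using that off anc_iff[of w y] True second_centre base_w anc_of_root by metis
      moreover have "\<not> anc w c" if two using that second_centre by simp
      ultimately show ?thesis using True by (auto simp: side_def)
    next
      case False
      then show ?thesis using side_anc y by simp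
    qed
    then have base_p: "base (parent y) = base y" using base_eq_iff_side by simp
    have hp: "height (parent y) = height y - 1"
      using side_p py by (simp add: height_def)
    show ?thesis
    proof (cases "y \<in> spine")
      case False
      then have f: "foot (parent y) = foot y" using foot_parent y by simp
      show ?thesis
      proof (cases "foot y = base y")
        case True
        then show ?thesis
          using f base_p side_p hp hy a_le
          by (auto simp: code_def spider_parent_def side_def)
      next
        case foot_off: False
        have "foot y \<noteq> y" using False foot_spine y by metis
        \<comment> \<open>Thus the hair coordinate is positive and \<open>spider_parent\<close>
          decreases it.\<close>
        then have "height (foot y) < height y"
          using anc_same_depth[OF foot_anc] depth_eq foot_in side_foot height_foot_le y
          by (metis le_neq_implies_less)
        then show ?thesis
          using foot_off f base_p hp tip_foot(4)[OF y(1) foot_off]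
          by (auto simp: code_def spider_parent_def)
      qed
    next
      case True
      then have fy: "foot y = y" and p_spine: "parent y \<in> spine" and fp: "foot (parent y) = parent y"
        using foot_of_spine spine_anc anc_parent by blast+
      have cy: "code y = (\<sigma> (tip y), height y, 0)" using fy off by (simp add: code_def)
      show ?thesis
      proof (cases "base (parent y) = parent y")
        case True
        then have "height (parent y) = 0" using height_eq_0_iff py by simp
        then have "height y = 1" using hp hy by simp
        have "side (tip y) = side y" using tip_foot(5)[of y] fy off y by simp
        \<comment> \<open>The numbering makes the leg of this landmark hang at the centre on the
          side of \<open>y\<close>.\<close>
        then have "\<sigma> (tip y) < a \<longleftrightarrow> side y = 0"
          using enum_side[of "tip y"] tip_foot(1)[of y] fy off y by (simp add: side_def split: if_splits)
        moreover have "\<sigma> (tip y) < k" using tip_foot(3)[of y] fy off y by simp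
        ultimately show ?thesis
          using cy fp True \<open>height y = 1\<close> \<open>height (parent y) = 0\<close> side_p
          by (auto simp: code_def spider_parent_def side_def split: if_splits)
      next
        case False
        have "tip (parent y) = tip y"
          using tip_unique[OF surj _ _ False] tip[OF \<open>y \<in> spine\<close> off] anc_trans anc_parent by blast
        then show ?thesis
          using cy fp False hp hy height_eq_0_iff[OF py(1)]
          by (auto simp: code_def spider_parent_def)
      qed
    qed
  qed
qed

text \<open>Both edge relations are given by parent maps, so a bijection commuting with these is an
  isomorphism.\<close>

lemma graph_iso_spider:
  assumes "card V = card (spider_V two k r)"
  shows "graph_iso V E (spider_V two k r) (spider_E two a k r)"
proof -
  note surj = code_surj[OF assms]
  have root: "code x = (0, 0, 0) \<longleftrightarrow> x = c" if "x \<in> V" for x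
    using that code_inj root_in code_root by (metis inj_onD)
  have par: "y \<noteq> c \<and> x = parent y \<longleftrightarrow> code y \<noteq> (0, 0, 0) \<and> code x = spider_parent a k (code y)"
    if "x \<in> V" "y \<in> V" for x y
  proof (cases "y = c")
    case False
    then have "code x = spider_parent a k (code y) \<longleftrightarrow> code x = code (parent y)"
      using code_parent[OF surj \<open>y \<in> V\<close>] by simp
    also have "\<dots> \<longleftrightarrow> x = parent y"
      using inj_on_eq_iff[OF code_inj \<open>x \<in> V\<close> parent_in[OF \<open>y \<in> V\<close>]] .
    finally show ?thesis using False root \<open>y \<in> V\<close> by blast
  qed (simp add: code_root)
  have "E x y \<longleftrightarrow> spider_E two a k r (code x) (code y)" if "x \<in> V" "y \<in> V" for x y
  proof -
    have "E x y \<longleftrightarrow> x \<noteq> c \<and> y = parent x \<or> y \<noteq> c \<and> x = parent y"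
      using that edge_iff_parent[of x y] by argo
    also have "\<dots> \<longleftrightarrow> spider_E two a k r (code x) (code y)"
      using code_in[OF that(1)] code_in[OF that(2)]
      unfolding par[OF that] par[OF that(2,1)] spider_E_def by argo
    finally show ?thesis .
  qed
  then show ?thesis
    unfolding graph_iso_def using code_inj surj by (auto simp: bij_betw_def intro!: exI[of _ code])
qed

text \<open>Otherwise \<open>w\<close> and the first vertex of the bare leg at \<open>c\<close> are
  two neighbours of \<open>c\<close> with no landmark below them, so no landmark separates them.
  Such a vertex exists because \<open>0 < r\<close>.\<close>

lemma side_1_landmark:
  assumes "code ` V = spider_V two k r" "two" "0 < r"
  shows "\<exists>\<rho>\<in>R. anc w \<rho>"
proof (rule ccontr)
  assume none: "\<not> (\<exists>\<rho>\<in>R. anc w \<rho>)"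
  have "(k, 1, 0) \<in> spider_V two k r" using assms by (simp add: spider_V_def)
  then obtain y where y: "y \<in> V" "code y = (k, 1, 0)" using assms(1) by (metis imageE)
  then have f: "foot y = base y" "height y = 1" "side y = 0"
    using tip_foot(3)[OF y(1)] by (auto simp: code_def split: if_splits)
  then have "foot y = c" "\<not> anc w y" "depth y = 1"
    using assms(2) depth_eq[OF y(1)] unfolding base_def side_def by (auto split: if_splits)
  have "gdist E \<rho> y = gdist E \<rho> w" if \<rho>: "\<rho> \<in> R" for \<rho>
  proof (rule gdist_cong_anc)
    show "anc m y \<longleftrightarrow> anc m w" if m: "anc m \<rho>" for m
    proof
      assume "anc m y"
      moreover have "m \<in> spine" using m \<rho> by (auto simp: spine_def)
      ultimately have "m = c" using anc_foot \<open>foot y = c\<close> by fastforce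
      then show "anc m w" using anc_root second_centre assms(2) by blast
    next
      assume "anc m w"
      then have "m = c" using anc_iff[of m w] second_centre assms(2) none m \<rho> by auto
      then show "anc m y" using anc_root y by blast
    qed
  qed (use y R_in \<rho> second_centre assms(2) depth_w \<open>depth y = 1\<close> in auto)
  then have "y = w" using resolve second_centre assms(2) y by blast
  then show False using \<open>\<not> anc w y\<close> by simp
qed

text \<open>Otherwise every landmark is below \<open>w\<close> and reaches both \<open>c\<close> and
  the first vertex of the bare leg at \<open>w\<close> through \<open>w\<close>; both distances
  equal \<open>depth \<rho>\<close>.\<close>

lemma side_0_landmark:
  assumes "code ` V = spider_V two k r" "two" "0 < r"
  shows "\<exists>\<rho>\<in>R. \<not> anc w \<rho>"
proof (rule ccontr)
  assume all: "\<not> (\<exists>\<rho>\<in>R. \<not> anc w \<rho>)"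
  have "(Suc k, 1, 0) \<in> spider_V two k r" using assms by (simp add: spider_V_def)
  then obtain y where y: "y \<in> V" "code y = (Suc k, 1, 0)" using assms(1) by (metis imageE)
  then have f: "foot y = base y" "height y = 1" "side y = 1"
    using tip_foot(3)[OF y(1)] by (auto simp: code_def split: if_splits)
  then have "foot y = w" "anc w y" "depth y = 2"
    using assms(2) depth_eq[OF y(1)] unfolding base_def side_def by (auto split: if_splits)
  have "gdist E \<rho> y = gdist E \<rho> c" if \<rho>: "\<rho> \<in> R" for \<rho>
  proof -
    have "\<rho> \<in> V" using R_in \<rho> by blast
    obtain m where m: "anc m \<rho>" "anc m y" "depth m = meet_depth \<rho> y"
      using meet_depthE[OF \<open>\<rho> \<in> V\<close> y(1)] by blast
    have "m \<in> spine" using m \<rho> by (auto simp: spine_def)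
    then have "anc m w" using anc_foot m \<open>foot y = w\<close> by metis
    then have "meet_depth \<rho> y \<le> 1"
      using anc_depth_le[of m w] m second_centre assms(2) depth_w by simp
    moreover have "1 \<le> meet_depth \<rho> y"
      using meet_depth_ge[OF \<open>\<rho> \<in> V\<close>, of w y] all \<rho> \<open>anc w y\<close> depth_w assms(2) by auto
    ultimately have "gdist E \<rho> y = depth \<rho>"
      using gdist_meet[OF \<open>\<rho> \<in> V\<close> y(1)] \<open>depth y = 2\<close> by simp
    then show ?thesis
      using gdist_sym root_in \<open>\<rho> \<in> V\<close> by (simp add: depth_def)
  qed
  then have "y = c" using resolve root_in y by blast
  then show False using \<open>depth y = 2\<close> by simp
qed

end

section \<open>The centre of a tree\<close>

context rooted_tree
begin

text \<open>A vertex cannot leave the root in the direction of both ends of a path through it.\<close>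

lemma opposite_end:
  assumes "s \<in> V" "t \<in> V" "y \<in> V" "gdist E s t = depth s + depth t"
  shows "gdist E y s = depth y + depth s \<or> gdist E y t = depth y + depth t"
proof (rule ccontr)
  assume "\<not> ?thesis"
  then obtain m n where m: "anc m y" "anc m s" "m \<noteq> c" and n: "anc n y" "anc n t" "n \<noteq> c"
    using gdist_through_root assms by metis
  \<comment> \<open>The ancestors of \<open>y\<close> form a chain, so the upper one of
    \<open>m\<close> and \<open>n\<close> lies above both \<open>s\<close> and
    \<open>t\<close>.\<close>
  have "anc m n \<or> anc n m"
    using anc_chain[of m y n] anc_chain[of n y m] m n assms(3) nat_le_linear by blast
  then show False
    using common_anc_root[OF assms(1,2,4)] m n anc_trans by blast
qed

text \<open>One of the two ends is reached from \<open>y\<close> through the root, at distance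
  \<open>depth y + r\<close>, which is at most \<open>2 * r\<close>.\<close>

lemma depth_le_even_centre:
  assumes "s \<in> V" "t \<in> V" "y \<in> V" "gdist E s t = 2 * r" "depth s = r" "depth t = r"
    and "\<And>z. z \<in> V \<Longrightarrow> gdist E y z \<le> 2 * r"
  shows "depth y \<le> r"
  using opposite_end[of s t y] assms(7)[of s] assms(7)[of t] assms(1-6) by auto

text \<open>Compare with the end across the middle edge: from below \<open>w\<close> this is
  \<open>s\<close>, otherwise \<open>t\<close>. The walk to it passes through the root.\<close>

lemma depth_le_odd_centre:
  assumes st: "s \<in> V" "t \<in> V" "gdist E s t = 2 * r + 1" "depth s = r" "depth t = Suc r"
    and w: "anc w t" "depth w = 1"
    and y: "y \<in> V" "\<And>z. z \<in> V \<Longrightarrow> gdist E y z \<le> 2 * r + 1"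
  shows "depth y \<le> (if anc w y then Suc r else r)"
proof -
  have sum: "gdist E s t = depth s + depth t" using st by simp
  have le: "depth w \<le> depth m" if "anc m z" "z \<in> V" "m \<noteq> c" for m z
    using that w(2) depth_eq_0_iff[of m] anc_in[of m z] by linarith
  have "w \<noteq> c" using w(2) by auto
  show ?thesis
  proof (cases "anc w y")
    case True
    have "gdist E y s = depth y + depth s"
    proof (rule gdist_through_root)
      fix m assume m: "anc m y" "anc m s"
      show "m = c"
      proof (rule ccontr)
        assume "m \<noteq> c"
        then have "anc w m" using anc_chain[OF True m(1) y(1)] le m(1) y(1) by blast
        then have "anc w s" using m(2) anc_trans by blast
        then show False using common_anc_root[OF st(1,2) sum] w(1) \<open>w \<noteq> c\<close> by blast
      qed
    qed (use st y in auto)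
    then show ?thesis using y(2)[OF st(1)] st True by simp
  next
    case False
    have "gdist E y t = depth y + depth t"
    proof (rule gdist_through_root)
      fix m assume m: "anc m y" "anc m t"
      show "m = c"
      proof (rule ccontr)
        assume "m \<noteq> c"
        then have "anc w m" using anc_chain[OF w(1) m(2) st(2)] le m(1) y(1) by blast
        then show False using m(1) anc_trans False by blast
      qed
    qed (use st y in auto)
    then show ?thesis using y(2)[OF st(2)] st False by simp
  qed
qed

end

section \<open>Diameter and metric dimension are attained\<close>

lemma (in tree_graph) diameter_attained:
  obtains s t where "s \<in> V" "t \<in> V" "gdist E s t = diameter V E"
proof -
  have "{gdist E u v | u v. u \<in> V \<and> v \<in> V} = (\<lambda>(u, v). gdist E u v) ` (V \<times> V)" by auto
  then have "finite {gdist E u v | u v. u \<in> V \<and> v \<in> V}" using finite_V by simp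
  moreover have "V \<noteq> {}" using tree by (simp add: is_tree_def)
  ultimately have "diameter V E \<in> {gdist E u v | u v. u \<in> V \<and> v \<in> V}"
    unfolding diameter_def by (intro Max_in) auto
  then show thesis using that by force
qed

lemma (in tree_graph) gdist_le_diameter:
  assumes "u \<in> V" "v \<in> V"
  shows "gdist E u v \<le> diameter V E"
proof -
  have "{gdist E u v | u v. u \<in> V \<and> v \<in> V} = (\<lambda>(u, v). gdist E u v) ` (V \<times> V)" by auto
  then have "finite {gdist E u v | u v. u \<in> V \<and> v \<in> V}" using finite_V by simp
  then show ?thesis unfolding diameter_def using assms by (intro Max_ge) auto
qed

lemma (in tree_graph) metric_dim_attained:
  obtains R where "resolving_set V E R" "card R = metric_dim V E" "finite R"
proof -
  have "resolving_set V E V"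
    unfolding resolving_set_def using gdist_eq_0_iff by (metis gdist_self order_refl)
  then have "\<exists>n R. resolving_set V E R \<and> card R = n" by blast
  from LeastI_ex[OF this] have "\<exists>R. resolving_set V E R \<and> card R = metric_dim V E"
    unfolding metric_dim_def .
  then show thesis using that finite_V finite_subset by (metis resolving_set_def)
qed

lemma (in tree_graph) metric_dim_le:
  "resolving_set V E R \<Longrightarrow> metric_dim V E \<le> card R"
  unfolding metric_dim_def by (intro Least_le) blast

text \<open>Elements satisfying \<open>P\<close> are numbered first, and \<open>a\<close> is their
  number. This distributes the landmarks over the legs at the two centres.\<close>

lemma ex_enum_separating:
  fixes P :: "'a \<Rightarrow> bool"
  assumes "finite R"
  obtains \<sigma> :: "'a \<Rightarrow> nat" and a where "bij_betw \<sigma> R {..<card R}" "a \<le> card R"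
    "\<And>\<rho>. \<rho> \<in> R \<Longrightarrow> \<sigma> \<rho> < a \<longleftrightarrow> P \<rho>"
proof -
  let ?A = "{\<rho> \<in> R. P \<rho>}" and ?B = "{\<rho> \<in> R. \<not> P \<rho>}"
  have AB: "card R = card ?A + card ?B"
    using assms by (subst card_Un_disjoint[symmetric]) (auto intro: arg_cong[of _ _ card])
  obtain f :: "'a \<Rightarrow> nat" where f: "bij_betw f ?A {..<card ?A}"
    using finite_same_card_bij[of ?A "{..<card ?A}"] assms by auto
  obtain g :: "'a \<Rightarrow> nat" where g: "bij_betw g ?B {card ?A..<card R}"
  proof -
    have "card ?B = card {card ?A..<card R}" unfolding AB by simp
    then show thesis using finite_same_card_bij[of ?B "{card ?A..<card R}"] assms that by auto
  qed
  let ?\<sigma> = "\<lambda>\<rho>. if P \<rho> then f \<rho> else g \<rho>"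
  have "bij_betw ?\<sigma> ?A {..<card ?A}" using f by (subst bij_betw_cong[of _ _ f]) auto
  moreover have "bij_betw ?\<sigma> ?B {card ?A..<card R}" using g by (subst bij_betw_cong[of _ _ g]) auto
  ultimately have "bij_betw ?\<sigma> (?A \<union> ?B) ({..<card ?A} \<union> {card ?A..<card R})"
    by (rule bij_betw_combine) auto
  moreover have "?A \<union> ?B = R" "{..<card ?A} \<union> {card ?A..<card R} = {..<card R}"
    using AB by auto
  ultimately have "bij_betw ?\<sigma> R {..<card R}" by simp
  moreover have "card ?A \<le> card R" using AB by simp
  moreover have "?\<sigma> \<rho> < card ?A \<longleftrightarrow> P \<rho>" if "\<rho> \<in> R" for \<rho>
    using that bij_betwE[OF f] bij_betwE[OF g] by (cases "P \<rho>") force+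
  ultimately show thesis using that by blast
qed

section \<open>The bound\<close>

lemma (in tree_graph) even_diameter_bound:
  assumes "diameter V E = 2 * r" "metric_dim V E = k"
  shows "card V \<le> card (spider_V False k r)"
    and "card V = card (spider_V False k r) \<Longrightarrow>
      graph_iso V E (spider_V False k r) (spider_E False k k r)"
proof -
  obtain s t where st: "s \<in> V" "t \<in> V" "gdist E s t = 2 * r"
    using diameter_attained assms by metis
  then obtain c where c: "c \<in> V" "gdist E s c = r" "gdist E c t = r"
    using gdist_split[of s t r r] by auto
  interpret rooted_tree V E c by unfold_locales (use tree c in auto)
  obtain R where R: "resolving_set V E R" "card R = k" "finite R"
    using metric_dim_attained assms by metis
  obtain \<sigma> :: "'a \<Rightarrow> nat" where \<sigma>: "bij_betw \<sigma> R {..<k}"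
    using R finite_same_card_bij[of R "{..<k}"] by auto
  have depth: "depth y \<le> r" if "y \<in> V" for y
    using depth_le_even_centre[OF st(1,2) that st(3)] c gdist_sym[OF st(1) c(1)]
      gdist_le_diameter[OF that] assms(1) by (simp add: depth_def)
  \<comment> \<open>With a single centre all landmarks count as lying on its side, hence
    \<open>a = k\<close>; \<open>c\<close> fills the place of \<open>w\<close>.\<close>
  interpret resolved_tree V E c R c False r k k \<sigma>
    by unfold_locales (use R \<sigma> depth in \<open>auto simp: bij_betw_def\<close>)
  show "card V \<le> card (spider_V False k r)" by (rule card_le)
  show "graph_iso V E (spider_V False k r) (spider_E False k k r)"
    if "card V = card (spider_V False k r)" using that by (rule graph_iso_spider)
qed

lemma (in tree_graph) odd_diameter_bound:
  assumes "diameter V E = 2 * r + 1" "metric_dim V E = k" "2 \<le> k"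
  shows "card V \<le> card (spider_V True k r)"
    and "card V = card (spider_V True k r) \<Longrightarrow>
      \<exists>a. 0 < a \<and> a < k \<and> graph_iso V E (spider_V True k r) (spider_E True a k r)"
proof -
  obtain s t where st: "s \<in> V" "t \<in> V" "gdist E s t = 2 * r + 1"
    using diameter_attained assms by metis
  then obtain c where c: "c \<in> V" "gdist E s c = r" "gdist E c t = Suc r"
    using gdist_split[of s t r "Suc r"] by auto
  interpret rooted_tree V E c by unfold_locales (use tree c in auto)
  have dst: "depth s = r" "depth t = Suc r"
    using c gdist_sym[OF st(1) c(1)] by (auto simp: depth_def)
  \<comment> \<open>The child of \<open>c\<close> towards \<open>t\<close>, that is, the other end
    of the middle edge.\<close>
  obtain w where w: "anc w t" "depth w = 1" using anc_of_depth[of t 1] st dst by auto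
  have w_in: "w \<in> V" "w \<noteq> c" using anc_in w st by auto
  then have "parent w = c"
    using depth_parent[of w] w depth_eq_0_iff[of "parent w"] parent_in by simp
  obtain R where R: "resolving_set V E R" "card R = k" "finite R"
    using metric_dim_attained assms by metis
  obtain \<sigma> :: "'a \<Rightarrow> nat" and a where \<sigma>: "bij_betw \<sigma> R {..<k}" "a \<le> k"
    "\<And>\<rho>. \<rho> \<in> R \<Longrightarrow> \<sigma> \<rho> < a \<longleftrightarrow> \<not> anc w \<rho>"
    using ex_enum_separating[OF R(3), of "\<lambda>\<rho>. \<not> anc w \<rho>"] R(2) by metis
  have depth: "depth y \<le> (if anc w y then Suc r else r)" if "y \<in> V" for y
    using depth_le_odd_centre[OF st dst w that] gdist_le_diameter[OF that] assms(1) by simp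
  interpret resolved_tree V E c R w True r k a \<sigma>
    by unfold_locales (use R \<sigma> depth w_in \<open>parent w = c\<close> in auto)
  show "card V \<le> card (spider_V True k r)" by (rule card_le)
  assume eq: "card V = card (spider_V True k r)"
  \<comment> \<open>For \<open>r = 0\<close> equality leaves a single edge, which one vertex
    resolves, against \<open>2 \<le> k\<close>.\<close>
  have "0 < r"
  proof (rule ccontr)
    assume "\<not> 0 < r"
    then have "2 * card V = 4" using eq card_spider_V[of True k r] by simp
    moreover have "{c, w} \<subseteq> V" "card {c, w} = 2" using w_in c by auto
    ultimately have "V = {c, w}" using card_subset_eq finite_V
      by (metis mult_2 mult_cancel1 numeral_Bit0 zero_neq_numeral)
    then have "resolving_set V E {c}"
      using gdist_eq_0_iff c w_in by (auto simp: resolving_set_def)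
    then show False using metric_dim_le assms by fastforce
  qed
  obtain \<rho> \<rho>' where \<rho>: "\<rho> \<in> R" "anc w \<rho>" "\<rho>' \<in> R" "\<not> anc w \<rho>'"
    using side_1_landmark side_0_landmark code_surj eq \<open>0 < r\<close> by blast
  \<comment> \<open>The landmark off \<open>w\<close> gives \<open>0 < a\<close>; the one below
    \<open>w\<close> gives \<open>a \<le> \<sigma> \<rho> < k\<close>.\<close>
  then have "\<not> \<sigma> \<rho> < a" "\<sigma> \<rho> < k" "\<sigma> \<rho>' < a"
    using \<sigma> by (auto simp: bij_betw_def)
  then have "0 < a \<and> a < k" by linarith
  then show "\<exists>a. 0 < a \<and> a < k \<and> graph_iso V E (spider_V True k r) (spider_E True a k r)"
    using graph_iso_spider[OF eq] by blast
qed

text \<open>Yields the converse in the equality statements: the spider has exactly the extremal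
  number of vertices.\<close>

lemma graph_iso_card: "graph_iso V E V' E' \<Longrightarrow> card V = card V'"
  unfolding graph_iso_def using bij_betw_same_card by blast

theorem theorem1:
  fixes V :: "'a set" and E :: "'a \<Rightarrow> 'a \<Rightarrow> bool" and d k :: nat
  assumes "is_tree V E"
    and "diameter V E = d"
    and "metric_dim V E = k"
    and "k \<ge> 2"
  shows "(even d \<longrightarrow>
            real (card V) \<le> (real k * real d + 4) * (real d + 2) / 8 \<and>
            (real (card V) = (real k * real d + 4) * (real d + 2) / 8 \<longleftrightarrow>
               graph_iso V E (HS_even_V d k) (HS_even_E d k))) \<and>
         (odd d \<longrightarrow>
            real (card V) \<le> (real k * real d - real k + 8) * (real d + 1) / 8 \<and>
            (real (card V) = (real k * real d - real k + 8) * (real d + 1) / 8 \<longleftrightarrow>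
               (\<exists>a::nat. 0 < a \<and> a < k \<and> graph_iso V E (HS_odd_V d k a) (HS_odd_E d k a))))"
proof -
  interpret tree_graph V E by unfold_locales (rule assms(1))
  show ?thesis
  proof (intro conjI impI)
    assume "even d"
    then obtain r where r: "d = 2 * r" by blast
    have S: "card V \<le> card (spider_V False k r)"
      "card V = card (spider_V False k r) \<Longrightarrow>
        graph_iso V E (spider_V False k r) (spider_E False k k r)"
      using even_diameter_bound assms(2,3) r by blast+
    \<comment> \<open>The size is known in doubled form over the naturals; this carries it to the
      reals, where the division is harmless.\<close>
    have "2 * real (card (spider_V False k r)) = real (2 * card (spider_V False k r))" by simp
    then have card: "real (card (spider_V False k r)) = (real k * real d + 4) * (real d + 2) / 8"
      unfolding card_spider_V r by (simp add: field_simps)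
    show "real (card V) \<le> (real k * real d + 4) * (real d + 2) / 8"
      using S(1) unfolding card[symmetric] by simp
    show "real (card V) = (real k * real d + 4) * (real d + 2) / 8 \<longleftrightarrow>
        graph_iso V E (HS_even_V d k) (HS_even_E d k)"
      unfolding card[symmetric] unfolding HS_even_V_eq HS_even_E_eq r
      using S(2) graph_iso_card by auto
  next
    assume "odd d"
    then obtain r where r: "d = 2 * r + 1" by (blast elim: oddE)
    have S: "card V \<le> card (spider_V True k r)"
      "card V = card (spider_V True k r) \<Longrightarrow>
        \<exists>a. 0 < a \<and> a < k \<and> graph_iso V E (spider_V True k r) (spider_E True a k r)"
      using odd_diameter_bound assms(2-4) r by blast+
    have "2 * real (card (spider_V True k r)) = real (2 * card (spider_V True k r))" by simp
    then have card:
      "real (card (spider_V True k r)) = (real k * real d - real k + 8) * (real d + 1) / 8"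
      unfolding card_spider_V r by (simp add: field_simps)
    show "real (card V) \<le> (real k * real d - real k + 8) * (real d + 1) / 8"
      using S(1) unfolding card[symmetric] by simp
    have "graph_iso V E (HS_odd_V d k a) (HS_odd_E d k a) \<longleftrightarrow>
        graph_iso V E (spider_V True k r) (spider_E True a k r)" if "a < k" for a
      using that r by (simp add: HS_odd_V_eq HS_odd_E_eq)
    then show "real (card V) = (real k * real d - real k + 8) * (real d + 1) / 8 \<longleftrightarrow>
        (\<exists>a::nat. 0 < a \<and> a < k \<and> graph_iso V E (HS_odd_V d k a) (HS_odd_E d k a))"
      unfolding card[symmetric] using S(2) graph_iso_card by (metis of_nat_eq_iff)
  qed
qed

end
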